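(* Let $q\colon E\to M$ be a submersion in a tangent category $(\mathbb X,\mathbb T)$ and let $H\colon Fq\to TE$ be a full horizontal connection on $q$. Then there exists a unique vertical connection $R_H\colon TE\to Vq$ on $q$ such that $(R_H,H)$ is an Ehresmann connection on $q$.
   Context: Composition is diagrammatic: $fg$ is $f$ followed by $g$; $\langle f,g\rangle$ denotes pairing into a (fibred) product, with projections $\pi_1,\pi_2$. A tangent category $(\mathbb X,\mathbb T)$ is a category $\mathbb X$ with an endofunctor $T$ and natural transformations $p_M\colon TM\to M$, $z_M\colon M\to TM$, $s_M\colon T_2M\to TM$, $l_M\colon TM\to T^2M$, $c_M\colon T^2M\to T^2M$, where the $n$-fold pullback $T_nM$ of $p_M$ along itself exists and is preserved by all $T^m$, such that: $(p_M,z_M,s_M)$ is an additive bundle (a commutative monoid in the category over $M$); $(z_M,l_M)\colon p_M\to Tp_M$ and $(\mathrm{id}_{TM},c_M)\colon Tp_M\to p_{TM}$ are additive bundle morphisms (commutative squares preserving zero and sum); $c_Mc_M=\mathrm{id}$, $l_Mc_M=l_M$, $l_M\,Tl_M=l_M\,l_{TM}$, $Tc_M\,c_{TM}\,Tc_M=c_{TM}\,Tc_M\,c_{TM}$, $l_{TM}\,Tc_M\,c_{TM}=c_M\,Tl_M$; and, with $\xi_M=\langle\pi_1l_M,\pi_2z_{TM}\rangle\,Ts_M\colon T_2M\to T^2M$, the square $\xi_M\,Tp_M=\pi_1p_Mz_M$ is a tangent pullback. A tangent pullback is a pullback preserved by $T^m$ for all $m\ge0$. A tangent display map is a morphism $q\colon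 E\to M$ such that for all $n\ge0$ and all $f\colon N\to T^nM$ the pullback of $T^nq$ along $f$ exists and is a tangent pullback. A differential bundle $\mathbf q\colon E\to M$ consists of $q\colon E\to M$, $z_q\colon M\to E$, $s_q\colon E_2\to E$, $l_q\colon E\to TE$ ($E_n$ the $n$-fold pullback of $q$ along itself, required to exist and be preserved by all $T^m$) such that $(q,z_q,s_q)$ is an additive bundle, $(z_M,l_q)\colon q\to Tq$ and $(z_q,l_q)\colon q\to p_E$ are additive bundle morphisms, $l_ql_E=l_q\,Tl_q$, and with $\xi_q=\langle\pi_1l_q,\pi_2z_E\rangle\,Ts_q\colon E_2\to TE$ the square $\xi_q\,Tq=\pi_1qz_M$ is a tangent pullback. Convention: all differential bundles are assumed display, i.e. $q$ is a tangent display map. A morphism $(f,g)\colon\mathbf q\to\mathbf q'$ (with $qf=gq'$) is linear if $g\,l_{q'}=l_q\,Tg$. $\mathsf{DB}(E)$ is the category of differential bundles over $E$ and linear morphisms over $\mathrm{id}_E$; it has finite biproducts, with zero object the trivial bundle $\mathbf 0_E=(\mathrm{id}_E,\mathrm{id}_E,\mathrm{id}_E,z_E)$. $\mathbf p_E=(p_E,z_E,s_E,l_E)$ is the tangent bundle. For a tangent display map $q\colon E\to M$: the vertical bundle $\mathbf q^V\colon Vq\to E$ is given by the tangent pullback $Vq$ of $Tq$ along $z_M$, with projections $\iota_q\colon Vq\to TE$ and $T^Vq\colon Vq\to M$; $q^V=\iota_qp_E$, and its zero $z_q^V$, sum $s^V_q$, lift $l_q^V$ are determined by $z_q^V\iota_q=z_E$,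 $s_q^V\iota_q=(\iota_q\times\iota_q)s_E$, $l_q^V\,T\iota_q=\iota_ql_E$. The Finsler bundle $\mathbf q^F\colon Fq\to E$ is given by the tangent pullback $Fq$ of $q$ along $p_M$, with projections $q^F\colon Fq\to E$ and $T^Fq\colon Fq\to TM$, its zero $z_q^F$, sum $s_q^F$, lift $l_q^F$ determined by $z_q^Fq^F=\mathrm{id}_E$, $z_q^F\,T^Fq=qz_M$; $s_q^Fq^F=\pi_1q^F$, $s_q^F\,T^Fq=(T^Fq\times T^Fq)s_M$; $l_q^F\,Tq^F=q^Fz_E$, $l_q^F\,T(T^Fq)=T^Fq\,l_M$. The horizontal descent $\pi_q\colon TE\to Fq$ is the unique morphism with $\pi_qq^F=p_E$ and $\pi_q\,T^Fq=Tq$. The square $\iota_q\pi_q=q^Vz_q^F$ (with corners $\mathbf q^V,\mathbf p_E,\mathbf 0_E,\mathbf q^F$) is commutative in $\mathsf{DB}(E)$; $q$ is a submersion if it is a pushout in $\mathsf{DB}(E)$. A vertical connection on $q$ is $R\colon TE\to Vq$ with $\iota_qR=\mathrm{id}_{Vq}$ and $R\colon\mathbf p_E\to\mathbf q^V$ linear over $E$ ($Rq^V=p_E$, $Rl_q^V=l_E\,TR$). A horizontal connection on $q$ is $H\colon Fq\to TE$ with $H\pi_q=\mathrm{id}_{Fq}$ and $H\colon\mathbf q^F\to\mathbf p_E$ linear over $E$ ($Hp_E=q^F$, $Hl_E=l_q^F\,TH$). It is full if the square $z_q^V\iota_q=z_q^FH$ (with corners $\mathbf 0_E,\mathbf q^V,\mathbf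 q^F,\mathbf p_E$) is a pushout in $\mathsf{DB}(E)$. An Ehresmann connection on $q$ is a pair $(R,H)$ of a vertical and a horizontal connection with $HR=q^Fz_q^V$ and $\langle R\iota_q,\pi_qH\rangle s_E=\mathrm{id}_{TE}$. *)

theory Defs
  imports Main
begin

section \<open>Categories\<close>

text \<open>Composition is diagrammatic: \<open>f \<Zsemi> g\<close> is \<open>f\<close> followed by \<open>g\<close>. The operations are total
  functions, but they are meaningful on \<open>obj\<close>, \<open>arr\<close> and composable pairs only.\<close>

record ('o, 'a) category =
  obj :: "'o set"
  arr :: "'a set"
  src :: "'a \<Rightarrow> 'o"
  tgt :: "'a \<Rightarrow> 'o"
  ident :: "'o \<Rightarrow> 'a"
  cmp :: "'a \<Rightarrow> 'a \<Rightarrow> 'a"  (infixl "\<Zsemi>\<index>" 70)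

definition hom :: "('o, 'a, 'x) category_scheme \<Rightarrow> 'o \<Rightarrow> 'o \<Rightarrow> 'a set" where
  "hom C A B = {f \<in> arr C. src C f = A \<and> tgt C f = B}"

locale category =
  fixes C :: "('o, 'a, 'x) category_scheme" (structure)
  assumes src_obj: "f \<in> arr C \<Longrightarrow> src C f \<in> obj C"
    and tgt_obj: "f \<in> arr C \<Longrightarrow> tgt C f \<in> obj C"
    and ident_hom: "A \<in> obj C \<Longrightarrow> ident C A \<in> hom C A A"
    and cmp_hom: "\<lbrakk>f \<in> hom C A B; g \<in> hom C B D\<rbrakk> \<Longrightarrow> f \<Zsemi> g \<in> hom C A D"
    and ident_cmp: "f \<in> hom C A B \<Longrightarrow> ident C A \<Zsemi> f = f"
    and cmp_ident: "f \<in> hom C A B \<Longrightarrow> f \<Zsemi> ident C B = f"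
    and cmp_assoc: "\<lbrakk>f \<in> hom C A B; g \<in> hom C B D; h \<in> hom C D E\<rbrakk>
      \<Longrightarrow> (f \<Zsemi> g) \<Zsemi> h = f \<Zsemi> (g \<Zsemi> h)"

text \<open>Pullback of the cospan \<open>(f, g)\<close>, with legs \<open>a\<close> and \<open>b\<close> over the sources of \<open>f\<close> and \<open>g\<close>.
  A pullback is given by its legs; its vertex is their common source.\<close>

definition is_pullback :: "('o, 'a, 'x) category_scheme \<Rightarrow> 'a \<Rightarrow> 'a \<Rightarrow> 'a \<Rightarrow> 'a \<Rightarrow> bool" where
  "is_pullback C f g a b \<longleftrightarrow>
     f \<in> arr C \<and> g \<in> arr C \<and> tgt C f = tgt C g \<and>
     a \<in> hom C (src C a) (src C f) \<and> b \<in> hom C (src C a) (src C g) \<and>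
     a \<Zsemi>\<^bsub>C\<^esub> f = b \<Zsemi>\<^bsub>C\<^esub> g \<and>
     (\<forall>X\<in>obj C. \<forall>x\<in>hom C X (src C f). \<forall>y\<in>hom C X (src C g). x \<Zsemi>\<^bsub>C\<^esub> f = y \<Zsemi>\<^bsub>C\<^esub> g \<longrightarrow>
        (\<exists>!h. h \<in> hom C X (src C a) \<and> h \<Zsemi>\<^bsub>C\<^esub> a = x \<and> h \<Zsemi>\<^bsub>C\<^esub> b = y))"

text \<open>Pushout of the span \<open>(f, g)\<close>, with coprojections \<open>a\<close> and \<open>b\<close> from the targets of \<open>f\<close> and
  \<open>g\<close>. In particular all four arrows belong to \<open>C\<close>.\<close>

definition is_pushout :: "('o, 'a, 'x) category_scheme \<Rightarrow> 'a \<Rightarrow> 'a \<Rightarrow> 'a \<Rightarrow> 'a \<Rightarrow> bool" where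
  "is_pushout C f g a b \<longleftrightarrow>
     f \<in> arr C \<and> g \<in> arr C \<and> src C f = src C g \<and>
     a \<in> hom C (tgt C f) (tgt C a) \<and> b \<in> hom C (tgt C g) (tgt C a) \<and>
     f \<Zsemi>\<^bsub>C\<^esub> a = g \<Zsemi>\<^bsub>C\<^esub> b \<and>
     (\<forall>X\<in>obj C. \<forall>x\<in>hom C (tgt C f) X. \<forall>y\<in>hom C (tgt C g) X. f \<Zsemi>\<^bsub>C\<^esub> x = g \<Zsemi>\<^bsub>C\<^esub> y \<longrightarrow>
        (\<exists>!h. h \<in> hom C (tgt C a) X \<and> a \<Zsemi>\<^bsub>C\<^esub> h = x \<and> b \<Zsemi>\<^bsub>C\<^esub> h = y))"

text \<open>The pairing \<open>\<langle>x, y\<rangle>\<close> into a pullback with legs \<open>a\<close> and \<open>b\<close>.\<close>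

definition pair :: "('o, 'a, 'x) category_scheme \<Rightarrow> 'a \<Rightarrow> 'a \<Rightarrow> 'a \<Rightarrow> 'a \<Rightarrow> 'a" where
  "pair C a b x y =
     (THE h. h \<in> hom C (src C x) (src C a) \<and> h \<Zsemi>\<^bsub>C\<^esub> a = x \<and> h \<Zsemi>\<^bsub>C\<^esub> b = y)"

text \<open>The \<open>n\<close>-fold pullback of \<open>q: E \<rightarrow> M\<close> along itself, that is, the \<open>n\<close>-fold product of \<open>q\<close> in the
  slice over \<open>M\<close>. The cone carries its structure map \<open>b\<close> to \<open>M\<close> besides the projections
  \<open>\<pi> 0, \<dots>, \<pi> (n - 1)\<close>, so that the case \<open>n = 0\<close> is covered (with \<open>E\<^sub>0 = M\<close>).\<close>

definition is_fibre_power ::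
    "('o, 'a, 'x) category_scheme \<Rightarrow> nat \<Rightarrow> 'a \<Rightarrow> 'a \<Rightarrow> (nat \<Rightarrow> 'a) \<Rightarrow> bool" where
  "is_fibre_power C n q b \<pi> \<longleftrightarrow>
     q \<in> arr C \<and> b \<in> hom C (src C b) (tgt C q) \<and>
     (\<forall>i<n. \<pi> i \<in> hom C (src C b) (src C q) \<and> \<pi> i \<Zsemi>\<^bsub>C\<^esub> q = b) \<and>
     (\<forall>X\<in>obj C. \<forall>y\<in>hom C X (tgt C q). \<forall>x.
        (\<forall>i<n. x i \<in> hom C X (src C q) \<and> x i \<Zsemi>\<^bsub>C\<^esub> q = y) \<longrightarrow>
        (\<exists>!h. h \<in> hom C X (src C b) \<and> h \<Zsemi>\<^bsub>C\<^esub> b = y \<and> (\<forall>i<n. h \<Zsemi>\<^bsub>C\<^esub> \<pi> i = x i)))"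

section \<open>Additive bundles\<close>

text \<open>The pullback \<open>E\<^sub>2\<close> is part of the data, through its two projections.\<close>

record 'a abundle =
  bproj :: 'a
  bzero :: 'a
  bfst :: 'a
  bsnd :: 'a
  bsum :: 'a

definition additive_bundle ::
    "('o, 'a, 'x) category_scheme \<Rightarrow> ('a, 'b) abundle_scheme \<Rightarrow> bool" where
  "additive_bundle C B \<longleftrightarrow>
     (let q = bproj B; z = bzero B; p1 = bfst B; p2 = bsnd B; s = bsum B;
          E = src C q; M = tgt C q in
      is_pullback C q q p1 p2 \<and>
      (\<forall>n. \<exists>b \<pi>. is_fibre_power C n q b \<pi>) \<and>
      z \<in> hom C M E \<and> z \<Zsemi>\<^bsub>C\<^esub> q = ident C M \<and>
      s \<in> hom C (src C p1) E \<and> s \<Zsemi>\<^bsub>C\<^esub> q = p1 \<Zsemi>\<^bsub>C\<^esub> q \<and>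
      pair C p1 p2 (q \<Zsemi>\<^bsub>C\<^esub> z) (ident C E) \<Zsemi>\<^bsub>C\<^esub> s = ident C E \<and>
      pair C p1 p2 (ident C E) (q \<Zsemi>\<^bsub>C\<^esub> z) \<Zsemi>\<^bsub>C\<^esub> s = ident C E \<and>
      pair C p1 p2 p2 p1 \<Zsemi>\<^bsub>C\<^esub> s = s \<and>
      (\<forall>b \<pi>. is_fibre_power C 3 q b \<pi> \<longrightarrow>
         pair C p1 p2 (pair C p1 p2 (\<pi> 0) (\<pi> 1) \<Zsemi>\<^bsub>C\<^esub> s) (\<pi> 2) \<Zsemi>\<^bsub>C\<^esub> s =
         pair C p1 p2 (\<pi> 0) (pair C p1 p2 (\<pi> 1) (\<pi> 2) \<Zsemi>\<^bsub>C\<^esub> s) \<Zsemi>\<^bsub>C\<^esub> s))"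

definition additive_bundle_morphism ::
    "('o, 'a, 'x) category_scheme \<Rightarrow> ('a, 'b) abundle_scheme \<Rightarrow> ('a, 'c) abundle_scheme \<Rightarrow>
     'a \<Rightarrow> 'a \<Rightarrow> bool" where
  "additive_bundle_morphism C B B' f g \<longleftrightarrow>
     f \<in> hom C (tgt C (bproj B)) (tgt C (bproj B')) \<and>
     g \<in> hom C (src C (bproj B)) (src C (bproj B')) \<and>
     bproj B \<Zsemi>\<^bsub>C\<^esub> f = g \<Zsemi>\<^bsub>C\<^esub> bproj B' \<and>
     bzero B \<Zsemi>\<^bsub>C\<^esub> g = f \<Zsemi>\<^bsub>C\<^esub> bzero B' \<and>
     bsum B \<Zsemi>\<^bsub>C\<^esub> g =
       pair C (bfst B') (bsnd B') (bfst B \<Zsemi>\<^bsub>C\<^esub> g) (bsnd B \<Zsemi>\<^bsub>C\<^esub> g) \<Zsemi>\<^bsub>C\<^esub> bsum B'"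

section \<open>Tangent categories\<close>

text \<open>The pullback \<open>T\<^sub>2 M\<close>, given by its projections \<open>tan_fst M\<close> and \<open>tan_snd M\<close>, is part of the
  structure because it is the source of the sum \<open>s\<^sub>M\<close>.\<close>

record ('o, 'a) tangent_structure = "('o, 'a) category" +
  Tob :: "'o \<Rightarrow> 'o"
  Tar :: "'a \<Rightarrow> 'a"
  tan_p :: "'o \<Rightarrow> 'a"
  tan_z :: "'o \<Rightarrow> 'a"
  tan_fst :: "'o \<Rightarrow> 'a"
  tan_snd :: "'o \<Rightarrow> 'a"
  tan_s :: "'o \<Rightarrow> 'a"
  tan_l :: "'o \<Rightarrow> 'a"
  tan_c :: "'o \<Rightarrow> 'a"

definition tangent_pullback ::
    "('o, 'a) tangent_structure \<Rightarrow> 'a \<Rightarrow> 'a \<Rightarrow> 'a \<Rightarrow> 'a \<Rightarrow> bool" where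
  "tangent_pullback X f g a b \<longleftrightarrow>
     (\<forall>m. is_pullback X ((Tar X ^^ m) f) ((Tar X ^^ m) g) ((Tar X ^^ m) a) ((Tar X ^^ m) b))"

definition tangent_fibre_powers :: "('o, 'a) tangent_structure \<Rightarrow> 'a \<Rightarrow> bool" where
  "tangent_fibre_powers X q \<longleftrightarrow>
     (\<forall>n. \<exists>b \<pi>. \<forall>m.
        is_fibre_power X n ((Tar X ^^ m) q) ((Tar X ^^ m) b) (\<lambda>i. (Tar X ^^ m) (\<pi> i)))"

definition T_abundle ::
    "('o, 'a) tangent_structure \<Rightarrow> ('a, 'b) abundle_scheme \<Rightarrow> 'a abundle" where
  "T_abundle X B = \<lparr>bproj = Tar X (bproj B), bzero = Tar X (bzero B),
     bfst = Tar X (bfst B), bsnd = Tar X (bsnd B), bsum = Tar X (bsum B)\<rparr>"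

definition tan_abundle :: "('o, 'a) tangent_structure \<Rightarrow> 'o \<Rightarrow> 'a abundle" where
  "tan_abundle X M = \<lparr>bproj = tan_p X M, bzero = tan_z X M,
     bfst = tan_fst X M, bsnd = tan_snd X M, bsum = tan_s X M\<rparr>"

locale tangent_category = category X
  for X :: "('o, 'a) tangent_structure" (structure) +
  assumes Tob_obj: "M \<in> obj X \<Longrightarrow> Tob X M \<in> obj X"
    and Tar_hom: "f \<in> hom X M N \<Longrightarrow> Tar X f \<in> hom X (Tob X M) (Tob X N)"
    and Tar_ident: "M \<in> obj X \<Longrightarrow> Tar X (ident X M) = ident X (Tob X M)"
    and Tar_cmp: "\<lbrakk>f \<in> hom X M N; g \<in> hom X N P\<rbrakk> \<Longrightarrow> Tar X (f \<Zsemi> g) = Tar X f \<Zsemi> Tar X g"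
    and p_hom: "M \<in> obj X \<Longrightarrow> tan_p X M \<in> hom X (Tob X M) M"
    and p_natural: "f \<in> hom X M N \<Longrightarrow> Tar X f \<Zsemi> tan_p X N = tan_p X M \<Zsemi> f"
    and z_hom: "M \<in> obj X \<Longrightarrow> tan_z X M \<in> hom X M (Tob X M)"
    and z_natural: "f \<in> hom X M N \<Longrightarrow> f \<Zsemi> tan_z X N = tan_z X M \<Zsemi> Tar X f"
    and T2_pullback: "M \<in> obj X \<Longrightarrow>
      tangent_pullback X (tan_p X M) (tan_p X M) (tan_fst X M) (tan_snd X M)"
    and Tn_pullback: "M \<in> obj X \<Longrightarrow> tangent_fibre_powers X (tan_p X M)"
    and s_hom: "M \<in> obj X \<Longrightarrow> tan_s X M \<in> hom X (src X (tan_fst X M)) (Tob X M)"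
    and s_natural: "f \<in> hom X M N \<Longrightarrow>
      pair X (tan_fst X N) (tan_snd X N) (tan_fst X M \<Zsemi> Tar X f) (tan_snd X M \<Zsemi> Tar X f)
        \<Zsemi> tan_s X N = tan_s X M \<Zsemi> Tar X f"
    and l_hom: "M \<in> obj X \<Longrightarrow> tan_l X M \<in> hom X (Tob X M) (Tob X (Tob X M))"
    and l_natural: "f \<in> hom X M N \<Longrightarrow>
      Tar X f \<Zsemi> tan_l X N = tan_l X M \<Zsemi> Tar X (Tar X f)"
    and c_hom: "M \<in> obj X \<Longrightarrow> tan_c X M \<in> hom X (Tob X (Tob X M)) (Tob X (Tob X M))"
    and c_natural: "f \<in> hom X M N \<Longrightarrow>
      Tar X (Tar X f) \<Zsemi> tan_c X N = tan_c X M \<Zsemi> Tar X (Tar X f)"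
    and p_additive: "M \<in> obj X \<Longrightarrow> additive_bundle X (tan_abundle X M)"
    and l_additive: "M \<in> obj X \<Longrightarrow>
      additive_bundle_morphism X (tan_abundle X M) (T_abundle X (tan_abundle X M))
        (tan_z X M) (tan_l X M)"
    and c_additive: "M \<in> obj X \<Longrightarrow>
      additive_bundle_morphism X (T_abundle X (tan_abundle X M)) (tan_abundle X (Tob X M))
        (ident X (Tob X M)) (tan_c X M)"
    and c_c: "M \<in> obj X \<Longrightarrow> tan_c X M \<Zsemi> tan_c X M = ident X (Tob X (Tob X M))"
    and l_c: "M \<in> obj X \<Longrightarrow> tan_l X M \<Zsemi> tan_c X M = tan_l X M"
    and l_l: "M \<in> obj X \<Longrightarrow>
      tan_l X M \<Zsemi> Tar X (tan_l X M) = tan_l X M \<Zsemi> tan_l X (Tob X M)"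
    and c_c_c: "M \<in> obj X \<Longrightarrow>
      Tar X (tan_c X M) \<Zsemi> tan_c X (Tob X M) \<Zsemi> Tar X (tan_c X M) =
      tan_c X (Tob X M) \<Zsemi> Tar X (tan_c X M) \<Zsemi> tan_c X (Tob X M)"
    and l_c_c: "M \<in> obj X \<Longrightarrow>
      tan_l X (Tob X M) \<Zsemi> Tar X (tan_c X M) \<Zsemi> tan_c X (Tob X M) =
      tan_c X M \<Zsemi> Tar X (tan_l X M)"
    and lift_universal: "M \<in> obj X \<Longrightarrow>
      tangent_pullback X (Tar X (tan_p X M)) (tan_z X M)
        (pair X (Tar X (tan_fst X M)) (Tar X (tan_snd X M))
           (tan_fst X M \<Zsemi> tan_l X M) (tan_snd X M \<Zsemi> tan_z X (Tob X M)) \<Zsemi> Tar X (tan_s X M))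
        (tan_fst X M \<Zsemi> tan_p X M)"

definition tangent_display_map :: "('o, 'a) tangent_structure \<Rightarrow> 'a \<Rightarrow> bool" where
  "tangent_display_map X q \<longleftrightarrow>
     q \<in> arr X \<and>
     (\<forall>n. \<forall>N\<in>obj X. \<forall>f\<in>hom X N ((Tob X ^^ n) (tgt X q)).
        \<exists>a b. tangent_pullback X ((Tar X ^^ n) q) f a b)"

section \<open>Differential bundles\<close>

record 'a dbundle = "'a abundle" +
  blift :: 'a

definition tan_dbundle :: "('o, 'a) tangent_structure \<Rightarrow> 'o \<Rightarrow> 'a dbundle" where
  "tan_dbundle X M = \<lparr>bproj = tan_p X M, bzero = tan_z X M,
     bfst = tan_fst X M, bsnd = tan_snd X M, bsum = tan_s X M, blift = tan_l X M\<rparr>"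

definition trivial_dbundle :: "('o, 'a) tangent_structure \<Rightarrow> 'o \<Rightarrow> 'a dbundle" where
  "trivial_dbundle X M = \<lparr>bproj = ident X M, bzero = ident X M,
     bfst = ident X M, bsnd = ident X M, bsum = ident X M, blift = tan_z X M\<rparr>"

definition differential_bundle :: "('o, 'a) tangent_structure \<Rightarrow> 'a dbundle \<Rightarrow> bool" where
  "differential_bundle X B \<longleftrightarrow>
     (let q = bproj B; z = bzero B; p1 = bfst B; p2 = bsnd B; s = bsum B; l = blift B;
          E = src X q; M = tgt X q in
      tangent_display_map X q \<and>
      tangent_pullback X q q p1 p2 \<and>
      tangent_fibre_powers X q \<and>
      additive_bundle X B \<and>
      additive_bundle_morphism X B (T_abundle X B) (tan_z X M) l \<and>
      additive_bundle_morphism X B (tan_abundle X E) z l \<and>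
      l \<Zsemi>\<^bsub>X\<^esub> tan_l X E = l \<Zsemi>\<^bsub>X\<^esub> Tar X l \<and>
      tangent_pullback X (Tar X q) (tan_z X M)
        (pair X (Tar X p1) (Tar X p2) (p1 \<Zsemi>\<^bsub>X\<^esub> l) (p2 \<Zsemi>\<^bsub>X\<^esub> tan_z X E) \<Zsemi>\<^bsub>X\<^esub> Tar X s)
        (p1 \<Zsemi>\<^bsub>X\<^esub> q))"

definition linear_morphism ::
    "('o, 'a) tangent_structure \<Rightarrow> 'a dbundle \<Rightarrow> 'a dbundle \<Rightarrow> 'a \<Rightarrow> 'a \<Rightarrow> bool" where
  "linear_morphism X B B' f g \<longleftrightarrow>
     f \<in> hom X (tgt X (bproj B)) (tgt X (bproj B')) \<and>
     g \<in> hom X (src X (bproj B)) (src X (bproj B')) \<and>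
     bproj B \<Zsemi>\<^bsub>X\<^esub> f = g \<Zsemi>\<^bsub>X\<^esub> bproj B' \<and>
     g \<Zsemi>\<^bsub>X\<^esub> blift B' = blift B \<Zsemi>\<^bsub>X\<^esub> Tar X g"

text \<open>The category of differential bundles over \<open>E\<close> and linear morphisms over the identity; an arrow
  is a triple (source bundle, arrow between the total objects, target bundle).\<close>

definition DB ::
    "('o, 'a) tangent_structure \<Rightarrow> 'o \<Rightarrow> ('a dbundle, 'a dbundle \<times> 'a \<times> 'a dbundle) category" where
  "DB X E =
     (let Ob = {B. differential_bundle X B \<and> tgt X (bproj B) = E} in
      \<lparr>obj = Ob,
       arr = {(B, g, B'). B \<in> Ob \<and> B' \<in> Ob \<and> linear_morphism X B B' (ident X E) g},
       src = (\<lambda>(B, g, B'). B),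
       tgt = (\<lambda>(B, g, B'). B'),
       ident = (\<lambda>B. (B, ident X (src X (bproj B)), B)),
       cmp = (\<lambda>(B, g, _) (_, g', B'). (B, g \<Zsemi>\<^bsub>X\<^esub> g', B'))\<rparr>)"

section \<open>Vertical and Finsler bundles\<close>

text \<open>The pullbacks \<open>Vq\<close> and \<open>Fq\<close>, and the pullbacks \<open>E\<^sub>2\<close> of their bundle structures, are defined
  up to isomorphism only, so we treat them as data: \<open>vertical_bundle X q V \<iota> t\<close> says that \<open>V\<close> is the
  vertical bundle of \<open>q\<close>, formed from a pullback with projections \<open>\<iota>\<close> and \<open>t\<close> (that is, \<open>T\<^sup>V q\<close>), and
  \<open>finsler_bundle X q F u\<close> that \<open>F\<close> is the Finsler bundle of \<open>q\<close>, formed from a pullback with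
  projections \<open>bproj F\<close> and \<open>u\<close> (that is, \<open>T\<^sup>F q\<close>).\<close>

definition vertical_bundle ::
    "('o, 'a) tangent_structure \<Rightarrow> 'a \<Rightarrow> 'a dbundle \<Rightarrow> 'a \<Rightarrow> 'a \<Rightarrow> bool" where
  "vertical_bundle X q V \<iota> t \<longleftrightarrow>
     (let E = src X q; M = tgt X q; Vq = src X \<iota> in
      tangent_pullback X (Tar X q) (tan_z X M) \<iota> t \<and>
      bproj V = \<iota> \<Zsemi>\<^bsub>X\<^esub> tan_p X E \<and>
      tangent_pullback X (bproj V) (bproj V) (bfst V) (bsnd V) \<and>
      bzero V \<in> hom X E Vq \<and>
      bzero V \<Zsemi>\<^bsub>X\<^esub> \<iota> = tan_z X E \<and>
      bsum V \<in> hom X (src X (bfst V)) Vq \<and>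
      bsum V \<Zsemi>\<^bsub>X\<^esub> \<iota> =
        pair X (tan_fst X E) (tan_snd X E) (bfst V \<Zsemi>\<^bsub>X\<^esub> \<iota>) (bsnd V \<Zsemi>\<^bsub>X\<^esub> \<iota>) \<Zsemi>\<^bsub>X\<^esub> tan_s X E \<and>
      blift V \<in> hom X Vq (Tob X Vq) \<and>
      blift V \<Zsemi>\<^bsub>X\<^esub> Tar X \<iota> = \<iota> \<Zsemi>\<^bsub>X\<^esub> tan_l X E)"

definition finsler_bundle ::
    "('o, 'a) tangent_structure \<Rightarrow> 'a \<Rightarrow> 'a dbundle \<Rightarrow> 'a \<Rightarrow> bool" where
  "finsler_bundle X q F u \<longleftrightarrow>
     (let E = src X q; M = tgt X q; Fq = src X (bproj F) in
      tangent_pullback X q (tan_p X M) (bproj F) u \<and>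
      tangent_pullback X (bproj F) (bproj F) (bfst F) (bsnd F) \<and>
      bzero F \<in> hom X E Fq \<and>
      bzero F \<Zsemi>\<^bsub>X\<^esub> bproj F = ident X E \<and>
      bzero F \<Zsemi>\<^bsub>X\<^esub> u = q \<Zsemi>\<^bsub>X\<^esub> tan_z X M \<and>
      bsum F \<in> hom X (src X (bfst F)) Fq \<and>
      bsum F \<Zsemi>\<^bsub>X\<^esub> bproj F = bfst F \<Zsemi>\<^bsub>X\<^esub> bproj F \<and>
      bsum F \<Zsemi>\<^bsub>X\<^esub> u =
        pair X (tan_fst X M) (tan_snd X M) (bfst F \<Zsemi>\<^bsub>X\<^esub> u) (bsnd F \<Zsemi>\<^bsub>X\<^esub> u) \<Zsemi>\<^bsub>X\<^esub> tan_s X M \<and>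
      blift F \<in> hom X Fq (Tob X Fq) \<and>
      blift F \<Zsemi>\<^bsub>X\<^esub> Tar X (bproj F) = bproj F \<Zsemi>\<^bsub>X\<^esub> tan_z X E \<and>
      blift F \<Zsemi>\<^bsub>X\<^esub> Tar X u = u \<Zsemi>\<^bsub>X\<^esub> tan_l X M)"

definition horizontal_descent ::
    "('o, 'a) tangent_structure \<Rightarrow> 'a \<Rightarrow> 'a dbundle \<Rightarrow> 'a \<Rightarrow> 'a" where
  "horizontal_descent X q F u = pair X (bproj F) u (tan_p X (src X q)) (Tar X q)"

definition submersion ::
    "('o, 'a) tangent_structure \<Rightarrow> 'a \<Rightarrow> 'a dbundle \<Rightarrow> 'a \<Rightarrow> 'a dbundle \<Rightarrow> 'a \<Rightarrow> bool" where
  "submersion X q V \<iota> F u \<longleftrightarrow>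
     (let E = src X q; P = tan_dbundle X E; Z = trivial_dbundle X E in
      tangent_display_map X q \<and>
      is_pushout (DB X E)
        (V, \<iota>, P) (V, bproj V, Z) (P, horizontal_descent X q F u, F) (Z, bzero F, F))"

section \<open>Connections\<close>

definition vertical_connection ::
    "('o, 'a) tangent_structure \<Rightarrow> 'a \<Rightarrow> 'a dbundle \<Rightarrow> 'a \<Rightarrow> 'a \<Rightarrow> bool" where
  "vertical_connection X q V \<iota> R \<longleftrightarrow>
     (let E = src X q in
      linear_morphism X (tan_dbundle X E) V (ident X E) R \<and>
      \<iota> \<Zsemi>\<^bsub>X\<^esub> R = ident X (src X \<iota>))"

definition horizontal_connection ::
    "('o, 'a) tangent_structure \<Rightarrow> 'a \<Rightarrow> 'a dbundle \<Rightarrow> 'a \<Rightarrow> 'a \<Rightarrow> bool" where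
  "horizontal_connection X q F u H \<longleftrightarrow>
     (let E = src X q in
      linear_morphism X F (tan_dbundle X E) (ident X E) H \<and>
      H \<Zsemi>\<^bsub>X\<^esub> horizontal_descent X q F u = ident X (src X (bproj F)))"

definition full_horizontal_connection ::
    "('o, 'a) tangent_structure \<Rightarrow> 'a \<Rightarrow> 'a dbundle \<Rightarrow> 'a \<Rightarrow> 'a dbundle \<Rightarrow> 'a \<Rightarrow> 'a \<Rightarrow> bool" where
  "full_horizontal_connection X q V \<iota> F u H \<longleftrightarrow>
     (let E = src X q; P = tan_dbundle X E; Z = trivial_dbundle X E in
      horizontal_connection X q F u H \<and>
      is_pushout (DB X E) (Z, bzero V, V) (Z, bzero F, F) (V, \<iota>, P) (F, H, P))"

definition ehresmann_connection ::
    "('o, 'a) tangent_structure \<Rightarrow> 'a \<Rightarrow> 'a dbundle \<Rightarrow> 'a \<Rightarrow> 'a dbundle \<Rightarrow> 'a \<Rightarrow> 'a \<Rightarrow> 'a \<Rightarrow> bool" where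
  "ehresmann_connection X q V \<iota> F u R H \<longleftrightarrow>
     (let E = src X q in
      vertical_connection X q V \<iota> R \<and> horizontal_connection X q F u H \<and>
      H \<Zsemi>\<^bsub>X\<^esub> R = bproj F \<Zsemi>\<^bsub>X\<^esub> bzero V \<and>
      pair X (tan_fst X E) (tan_snd X E)
        (R \<Zsemi>\<^bsub>X\<^esub> \<iota>) (horizontal_descent X q F u \<Zsemi>\<^bsub>X\<^esub> H) \<Zsemi>\<^bsub>X\<^esub> tan_s X E = ident X (Tob X E))"

end

theory Submission
  imports Defs
begin

text \<open>The trivial bundle is a zero object of the category of differential bundles over \<open>E\<close>. The square
  of a full horizontal connection is a pushout over it, so it exhibits the tangent bundle \<open>TE\<close> as the coproduct of
  \<open>Vq\<close> and \<open>Fq\<close> in this category, with coprojections \<open>\<iota>\<close> and \<open>H\<close>.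
  The equations \<open>\<iota> \<Zsemi> R = id\<close> and \<open>H \<Zsemi> R = q\<^sup>F \<Zsemi> z\<^sup>V\<close> demanded of an Ehresmann connection prescribe \<open>R\<close>
  on both summands. Since the zero morphism \<open>q\<^sup>F \<Zsemi> z\<^sup>V\<close> is linear, such an \<open>R\<close> exists, and it is unique
  because a vertical connection is an arrow of this category.

  It remains to see that \<open>\<langle>R \<Zsemi> \<iota>, \<pi> \<Zsemi> H\<rangle> \<Zsemi> s\<close> is the identity of \<open>TE\<close>, where \<open>\<pi>\<close> is the horizontal
  descent. This is the familiar argument that a coproduct of two objects is a biproduct: a sum of
  linear morphisms is linear (lemma \<open>DB_sum\<close>), so by the uniqueness part of the universal property it is enough to
  compare with the identity after \<open>\<iota>\<close> and after \<open>H\<close>. After \<open>\<iota>\<close> the second summand, and after \<open>H\<close>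
  the first one, is a zero morphism. The submersion hypothesis enters through the linearity of \<open>\<pi>\<close>
  and the equation \<open>\<iota> \<Zsemi> \<pi> = q\<^sup>V \<Zsemi> z\<^sup>F\<close>.\<close>

section \<open>Pairings into pullbacks\<close>

context category
begin

lemma pullback_arrow_eqI:
  assumes "is_pullback C f g a b"
    and "h \<in> hom C Y (src C a)" "k \<in> hom C Y (src C a)"
    and "h \<Zsemi> a = k \<Zsemi> a" "h \<Zsemi> b = k \<Zsemi> b"
  shows "h = k"
proof -
  have a: "a \<in> hom C (src C a) (src C f)" and b: "b \<in> hom C (src C a) (src C g)"
    and f: "f \<in> hom C (src C f) (tgt C f)" and g: "g \<in> hom C (src C g) (tgt C f)"
    and sq: "a \<Zsemi> f = b \<Zsemi> g"
    using assms(1) by (auto simp: is_pullback_def hom_def)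
  have Y: "Y \<in> obj C" using assms(2) src_obj by (auto simp: hom_def)
  have "(k \<Zsemi> a) \<Zsemi> f = (k \<Zsemi> b) \<Zsemi> g"
    using cmp_assoc[OF assms(3) a f] cmp_assoc[OF assms(3) b g] sq by simp
  then have "\<exists>!m. m \<in> hom C Y (src C a) \<and> m \<Zsemi> a = k \<Zsemi> a \<and> m \<Zsemi> b = k \<Zsemi> b"
    using assms(1) Y cmp_hom[OF assms(3) a] cmp_hom[OF assms(3) b] unfolding is_pullback_def by blast
  then show ?thesis using assms(2-5) by metis
qed

lemma pair_into_pullback:
  assumes "is_pullback C f g a b" "x \<in> hom C Y (src C f)" "y \<in> hom C Y (src C g)"
    and "x \<Zsemi> f = y \<Zsemi> g"
  shows "pair C a b x y \<in> hom C Y (src C a)"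
    and "pair C a b x y \<Zsemi> a = x" and "pair C a b x y \<Zsemi> b = y"
proof -
  have Y: "Y \<in> obj C" and sx: "src C x = Y" using assms(2) src_obj by (auto simp: hom_def)
  have "\<exists>!h. h \<in> hom C Y (src C a) \<and> h \<Zsemi> a = x \<and> h \<Zsemi> b = y"
    using assms Y unfolding is_pullback_def by blast
  from theI'[OF this] show "pair C a b x y \<in> hom C Y (src C a)"
    and "pair C a b x y \<Zsemi> a = x" and "pair C a b x y \<Zsemi> b = y"
    unfolding pair_def sx by auto
qed

lemma cmp_pair:
  assumes pb: "is_pullback C f g a b" and x: "x \<in> hom C Y (src C f)" and y: "y \<in> hom C Y (src C g)"
    and sq: "x \<Zsemi> f = y \<Zsemi> g" and k: "k \<in> hom C W Y"
  shows "k \<Zsemi> pair C a b x y = pair C a b (k \<Zsemi> x) (k \<Zsemi> y)"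
proof -
  have a: "a \<in> hom C (src C a) (src C f)" and b: "b \<in> hom C (src C a) (src C g)"
    and f: "f \<in> hom C (src C f) (tgt C f)" and g: "g \<in> hom C (src C g) (tgt C f)"
    using pb by (auto simp: is_pullback_def hom_def)
  note p = pair_into_pullback[OF pb x y sq]
  have "(k \<Zsemi> x) \<Zsemi> f = (k \<Zsemi> y) \<Zsemi> g"
    using cmp_assoc[OF k x f] cmp_assoc[OF k y g] sq by simp
  note p' = pair_into_pullback[OF pb cmp_hom[OF k x] cmp_hom[OF k y] this]
  show ?thesis
    by (rule pullback_arrow_eqI[OF pb cmp_hom[OF k p(1)] p'(1)])
      (simp_all add: p p' cmp_assoc[OF k p(1) a] cmp_assoc[OF k p(1) b])
qed

end

section \<open>Linear morphisms over a fixed base\<close>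

lemma DB_obj_iff: "B \<in> obj (DB X E) \<longleftrightarrow> differential_bundle X B \<and> tgt X (bproj B) = E"
  by (simp add: DB_def)

lemma DB_arr_iff: "(B, g, B') \<in> arr (DB X E) \<longleftrightarrow>
    B \<in> obj (DB X E) \<and> B' \<in> obj (DB X E) \<and> linear_morphism X B B' (ident X E) g"
  by (simp add: DB_def)

lemma DB_src_tgt: "src (DB X E) (B, g, B') = B" "tgt (DB X E) (B, g, B') = B'"
  by (simp_all add: DB_def)

lemma DB_cmp: "(B, g, B') \<Zsemi>\<^bsub>DB X E\<^esub> (D, h, D') = (B, g \<Zsemi>\<^bsub>X\<^esub> h, D')"
  by (simp add: DB_def)

lemma DB_pushout_commutes:
  assumes "is_pushout (DB X E) (A, f, B) (A, g, D) (B, a, P) (D, b, P)"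
  shows "f \<Zsemi>\<^bsub>X\<^esub> a = g \<Zsemi>\<^bsub>X\<^esub> b"
  using assms by (auto simp: is_pushout_def DB_cmp)

lemma DB_pushout_arr:
  assumes "is_pushout (DB X E) (A, f, B) (A, g, D) (B, a, P) (D, b, P)"
  shows "(A, f, B) \<in> arr (DB X E)" "(A, g, D) \<in> arr (DB X E)"
    "(B, a, P) \<in> arr (DB X E)" "(D, b, P) \<in> arr (DB X E)"
  using assms by (auto simp: is_pushout_def hom_def)

text \<open>An arrow of \<open>DB X E\<close> from \<open>P\<close> to \<open>Q\<close> is a triple whose outer components are forced, so the
  universal property can be read in terms of the underlying arrows of \<open>X\<close>.\<close>

lemma DB_pushout_universal:
  assumes po: "is_pushout (DB X E) (A, f, B) (A, g, D) (B, a, P) (D, b, P)"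
    and x: "(B, x, Q) \<in> arr (DB X E)" and y: "(D, y, Q) \<in> arr (DB X E)"
    and sq: "f \<Zsemi>\<^bsub>X\<^esub> x = g \<Zsemi>\<^bsub>X\<^esub> y"
  shows "\<exists>!h. (P, h, Q) \<in> arr (DB X E) \<and> a \<Zsemi>\<^bsub>X\<^esub> h = x \<and> b \<Zsemi>\<^bsub>X\<^esub> h = y"
proof -
  have "\<exists>!h. h \<in> hom (DB X E) P Q \<and>
      (B, a, P) \<Zsemi>\<^bsub>DB X E\<^esub> h = (B, x, Q) \<and> (D, b, P) \<Zsemi>\<^bsub>DB X E\<^esub> h = (D, y, Q)"
    using po x y sq unfolding is_pushout_def hom_def
    by (auto simp: DB_src_tgt DB_cmp DB_arr_iff)
  then obtain h where h: "h \<in> hom (DB X E) P Q"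
      "(B, a, P) \<Zsemi>\<^bsub>DB X E\<^esub> h = (B, x, Q)" "(D, b, P) \<Zsemi>\<^bsub>DB X E\<^esub> h = (D, y, Q)"
    and uniq: "\<And>k. k \<in> hom (DB X E) P Q \<Longrightarrow> (B, a, P) \<Zsemi>\<^bsub>DB X E\<^esub> k = (B, x, Q) \<Longrightarrow>
      (D, b, P) \<Zsemi>\<^bsub>DB X E\<^esub> k = (D, y, Q) \<Longrightarrow> k = h"
    by (elim ex1E) blast
  obtain k where k: "h = (P, k, Q)"
    using h(1) by (cases h) (simp add: hom_def DB_src_tgt)
  show ?thesis
  proof (rule ex1I)
    show "(P, k, Q) \<in> arr (DB X E) \<and> a \<Zsemi>\<^bsub>X\<^esub> k = x \<and> b \<Zsemi>\<^bsub>X\<^esub> k = y"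
      using h by (simp add: k hom_def DB_cmp)
    show "k' = k" if "(P, k', Q) \<in> arr (DB X E) \<and> a \<Zsemi>\<^bsub>X\<^esub> k' = x \<and> b \<Zsemi>\<^bsub>X\<^esub> k' = y" for k'
      using uniq[of "(P, k', Q)"] that by (simp add: k hom_def DB_src_tgt DB_cmp)
  qed
qed

context tangent_category
begin

lemma DB_arrD:
  assumes "(B, g, B') \<in> arr (DB X E)"
  shows "g \<in> hom X (src X (bproj B)) (src X (bproj B'))"
    and "g \<Zsemi> bproj B' = bproj B"
    and "g \<Zsemi> blift B' = blift B \<Zsemi> Tar X g"
proof -
  have q: "bproj B \<in> hom X (src X (bproj B)) E"
    and L: "linear_morphism X B B' (ident X E) g"
    using assms by (auto simp: DB_arr_iff DB_obj_iff differential_bundle_def Let_def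
        tangent_display_map_def hom_def)
  show "g \<in> hom X (src X (bproj B)) (src X (bproj B'))"
    and "g \<Zsemi> blift B' = blift B \<Zsemi> Tar X g"
    and "g \<Zsemi> bproj B' = bproj B"
    using L cmp_ident[OF q] by (auto simp: linear_morphism_def)
qed

lemma differential_bundleD:
  assumes "B \<in> obj (DB X E)"
  shows "E \<in> obj X"
    and "bproj B \<in> hom X (src X (bproj B)) E"
    and "bzero B \<in> hom X E (src X (bproj B))"
    and "bzero B \<Zsemi> bproj B = ident X E"
    and "bsum B \<in> hom X (src X (bfst B)) (src X (bproj B))"
    and "bsum B \<Zsemi> bproj B = bfst B \<Zsemi> bproj B"
    and "is_pullback X (bproj B) (bproj B) (bfst B) (bsnd B)"
    and "is_pullback X (Tar X (bproj B)) (Tar X (bproj B)) (Tar X (bfst B)) (Tar X (bsnd B))"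
    and "blift B \<in> hom X (src X (bproj B)) (Tob X (src X (bproj B)))"
    and "bproj B \<Zsemi> tan_z X E = blift B \<Zsemi> Tar X (bproj B)"
    and "bzero B \<Zsemi> blift B = tan_z X E \<Zsemi> Tar X (bzero B)"
    and "bsum B \<Zsemi> blift B =
      pair X (Tar X (bfst B)) (Tar X (bsnd B)) (bfst B \<Zsemi> blift B) (bsnd B \<Zsemi> blift B)
        \<Zsemi> Tar X (bsum B)"
    and "pair X (bfst B) (bsnd B) (bproj B \<Zsemi> bzero B) (ident X (src X (bproj B))) \<Zsemi> bsum B
      = ident X (src X (bproj B))"
    and "pair X (bfst B) (bsnd B) (ident X (src X (bproj B))) (bproj B \<Zsemi> bzero B) \<Zsemi> bsum B
      = ident X (src X (bproj B))"
proof -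
  have d: "differential_bundle X B" and E: "tgt X (bproj B) = E"
    using assms by (auto simp: DB_obj_iff)
  have A: "additive_bundle X B" and P: "tangent_pullback X (bproj B) (bproj B) (bfst B) (bsnd B)"
    and L: "additive_bundle_morphism X B (T_abundle X B) (tan_z X E) (blift B)"
    and q: "bproj B \<in> arr X"
    using d E by (auto simp: differential_bundle_def Let_def tangent_display_map_def)
  show q': "bproj B \<in> hom X (src X (bproj B)) E"
    using q E by (auto simp: hom_def)
  show E': "E \<in> obj X" using q E tgt_obj by auto
  have "Tar X (bproj B) \<in> hom X (Tob X (src X (bproj B))) (Tob X E)" by (rule Tar_hom[OF q'])
  then show "blift B \<in> hom X (src X (bproj B)) (Tob X (src X (bproj B)))"
    and "bproj B \<Zsemi> tan_z X E = blift B \<Zsemi> Tar X (bproj B)"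
    and "bzero B \<Zsemi> blift B = tan_z X E \<Zsemi> Tar X (bzero B)"
    and "bsum B \<Zsemi> blift B =
      pair X (Tar X (bfst B)) (Tar X (bsnd B)) (bfst B \<Zsemi> blift B) (bsnd B \<Zsemi> blift B)
        \<Zsemi> Tar X (bsum B)"
    using L by (auto simp: additive_bundle_morphism_def T_abundle_def hom_def)
  show "bzero B \<in> hom X E (src X (bproj B))"
    and "bzero B \<Zsemi> bproj B = ident X E"
    and "bsum B \<in> hom X (src X (bfst B)) (src X (bproj B))"
    and "bsum B \<Zsemi> bproj B = bfst B \<Zsemi> bproj B"
    and "pair X (bfst B) (bsnd B) (bproj B \<Zsemi> bzero B) (ident X (src X (bproj B))) \<Zsemi> bsum B
      = ident X (src X (bproj B))"
    and "pair X (bfst B) (bsnd B) (ident X (src X (bproj B))) (bproj B \<Zsemi> bzero B) \<Zsemi> bsum B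
      = ident X (src X (bproj B))"
    using A E by (auto simp: additive_bundle_def Let_def)
  show "is_pullback X (bproj B) (bproj B) (bfst B) (bsnd B)"
    and "is_pullback X (Tar X (bproj B)) (Tar X (bproj B)) (Tar X (bfst B)) (Tar X (bsnd B))"
    using P[unfolded tangent_pullback_def, rule_format, of 0]
      P[unfolded tangent_pullback_def, rule_format, of 1] by simp_all
qed

lemma DB_arrI:
  assumes "B \<in> obj (DB X E)" "B' \<in> obj (DB X E)"
    and "g \<in> hom X (src X (bproj B)) (src X (bproj B'))"
    and "g \<Zsemi> bproj B' = bproj B"
    and "g \<Zsemi> blift B' = blift B \<Zsemi> Tar X g"
  shows "(B, g, B') \<in> arr (DB X E)"
  using assms ident_hom[OF differential_bundleD(1)[OF assms(1)]]
    cmp_ident[OF differential_bundleD(2)[OF assms(1)]]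
  by (auto simp: DB_arr_iff linear_morphism_def DB_obj_iff)

lemma DB_ident:
  assumes B: "B \<in> obj (DB X E)"
  shows "(B, ident X (src X (bproj B)), B) \<in> arr (DB X E)"
proof -
  note d = differential_bundleD[OF B]
  have o: "src X (bproj B) \<in> obj X" using d(2) src_obj by (auto simp: hom_def)
  show ?thesis
    by (rule DB_arrI[OF B B ident_hom[OF o] ident_cmp[OF d(2)]])
      (simp add: ident_cmp[OF d(9)] Tar_ident[OF o] cmp_ident[OF d(9)])
qed

lemma DB_cmp_arr:
  assumes f: "(A, f, B) \<in> arr (DB X E)" and g: "(B, g, D) \<in> arr (DB X E)"
  shows "(A, f \<Zsemi> g, D) \<in> arr (DB X E)"
proof -
  have A: "A \<in> obj (DB X E)" and B: "B \<in> obj (DB X E)" and D: "D \<in> obj (DB X E)"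
    using f g by (auto simp: DB_arr_iff)
  note dA = differential_bundleD[OF A] and dB = differential_bundleD[OF B]
    and dD = differential_bundleD[OF D]
  note f' = DB_arrD[OF f] and g' = DB_arrD[OF g]
  show ?thesis
  proof (rule DB_arrI[OF A D cmp_hom[OF f'(1) g'(1)]])
    show "f \<Zsemi> g \<Zsemi> bproj D = bproj A"
      by (simp add: cmp_assoc[OF f'(1) g'(1) dD(2)] f' g')
    have "f \<Zsemi> g \<Zsemi> blift D = (f \<Zsemi> blift B) \<Zsemi> Tar X g"
      by (simp add: cmp_assoc[OF f'(1) g'(1) dD(9)] g'(3)
          cmp_assoc[OF f'(1) dB(9) Tar_hom[OF g'(1)]])
    also have "\<dots> = blift A \<Zsemi> Tar X (f \<Zsemi> g)"
      by (simp add: f'(3) Tar_cmp[OF f'(1) g'(1)]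
          cmp_assoc[OF dA(9) Tar_hom[OF f'(1)] Tar_hom[OF g'(1)]])
    finally show "f \<Zsemi> g \<Zsemi> blift D = blift A \<Zsemi> Tar X (f \<Zsemi> g)" .
  qed
qed

text \<open>Both lifts cover the zero \<open>z\<close> of the base: \<open>q \<Zsemi> z = l \<Zsemi> Tq\<close> for the projection \<open>q\<close> and lift \<open>l\<close> of
  \<open>A\<close>, and \<open>z' \<Zsemi> l' = z \<Zsemi> Tz'\<close> for the zero \<open>z'\<close> and lift \<open>l'\<close> of \<open>B\<close>. So \<open>q \<Zsemi> z'\<close> commutes with the
  lifts.\<close>

lemma DB_zero:
  assumes A: "A \<in> obj (DB X E)" and B: "B \<in> obj (DB X E)"
  shows "(A, bproj A \<Zsemi> bzero B, B) \<in> arr (DB X E)"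
proof -
  note dA = differential_bundleD[OF A] and dB = differential_bundleD[OF B]
  show ?thesis
  proof (rule DB_arrI[OF A B cmp_hom[OF dA(2) dB(3)]])
    show "bproj A \<Zsemi> bzero B \<Zsemi> bproj B = bproj A"
      by (simp add: cmp_assoc[OF dA(2) dB(3) dB(2)] dB(4) cmp_ident[OF dA(2)])
    have "bproj A \<Zsemi> bzero B \<Zsemi> blift B = (bproj A \<Zsemi> tan_z X E) \<Zsemi> Tar X (bzero B)"
      by (simp add: cmp_assoc[OF dA(2) dB(3) dB(9)] dB(11)
          cmp_assoc[OF dA(2) z_hom[OF dA(1)] Tar_hom[OF dB(3)]])
    also have "\<dots> = blift A \<Zsemi> Tar X (bproj A \<Zsemi> bzero B)"
      by (simp add: dA(10) Tar_cmp[OF dA(2) dB(3)]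
          cmp_assoc[OF dA(9) Tar_hom[OF dA(2)] Tar_hom[OF dB(3)]])
    finally show "bproj A \<Zsemi> bzero B \<Zsemi> blift B = blift A \<Zsemi> Tar X (bproj A \<Zsemi> bzero B)" .
  qed
qed

text \<open>The lift of the target preserves sums, and \<open>T\<close> preserves the pullback on which the sum is
  defined, so that \<open>T\<langle>f, g\<rangle>\<close> is determined by \<open>Tf\<close> and \<open>Tg\<close>. Hence the linearity of \<open>f\<close> and \<open>g\<close> can
  be applied summand by summand.\<close>

lemma DB_sum:
  assumes f: "(A, f, B) \<in> arr (DB X E)" and g: "(A, g, B) \<in> arr (DB X E)"
  shows "(A, pair X (bfst B) (bsnd B) f g \<Zsemi> bsum B, B) \<in> arr (DB X E)"
proof -
  have A: "A \<in> obj (DB X E)" and B: "B \<in> obj (DB X E)"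
    using f g by (auto simp: DB_arr_iff)
  note dA = differential_bundleD[OF A] and dB = differential_bundleD[OF B]
  note f' = DB_arrD[OF f] and g' = DB_arrD[OF g]
  let ?p1 = "bfst B" and ?p2 = "bsnd B" and ?l = "blift B" and ?k = "pair X (bfst B) (bsnd B) f g"
  have p1: "?p1 \<in> hom X (src X ?p1) (src X (bproj B))"
    and p2: "?p2 \<in> hom X (src X ?p1) (src X (bproj B))"
    and sq: "?p1 \<Zsemi> bproj B = ?p2 \<Zsemi> bproj B"
    using dB(7) by (auto simp: is_pullback_def)
  have "f \<Zsemi> bproj B = g \<Zsemi> bproj B" by (simp add: f' g')
  note k = pair_into_pullback[OF dB(7) f'(1) g'(1) this]
  have Tsrc: "src X (Tar X (bproj B)) = Tob X (src X (bproj B))"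
    "src X (Tar X ?p1) = Tob X (src X ?p1)"
    using Tar_hom[OF dB(2)] Tar_hom[OF p1] by (auto simp: hom_def)
  note T1 = Tar_hom[OF p1] and T2 = Tar_hom[OF p2] and Tk = Tar_hom[OF k(1)]
  have l1: "?p1 \<Zsemi> ?l \<in> hom X (src X ?p1) (src X (Tar X (bproj B)))"
    and l2: "?p2 \<Zsemi> ?l \<in> hom X (src X ?p1) (src X (Tar X (bproj B)))"
    using cmp_hom[OF p1 dB(9)] cmp_hom[OF p2 dB(9)] by (simp_all add: Tsrc)
  have "?p1 \<Zsemi> ?l \<Zsemi> Tar X (bproj B) = ?p1 \<Zsemi> bproj B \<Zsemi> tan_z X E"
    by (simp add: cmp_assoc[OF p1 dB(9) Tar_hom[OF dB(2)]] cmp_assoc[OF p1 dB(2) z_hom[OF dB(1)]]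
        dB(10))
  moreover have "?p2 \<Zsemi> ?l \<Zsemi> Tar X (bproj B) = ?p2 \<Zsemi> bproj B \<Zsemi> tan_z X E"
    by (simp add: cmp_assoc[OF p2 dB(9) Tar_hom[OF dB(2)]] cmp_assoc[OF p2 dB(2) z_hom[OF dB(1)]]
        dB(10))
  ultimately have "?p1 \<Zsemi> ?l \<Zsemi> Tar X (bproj B) = ?p2 \<Zsemi> ?l \<Zsemi> Tar X (bproj B)" by (simp add: sq)
  note m = pair_into_pullback[OF dB(8) l1 l2 this]
  let ?m = "pair X (Tar X ?p1) (Tar X ?p2) (?p1 \<Zsemi> ?l) (?p2 \<Zsemi> ?l)"
  have m1: "?m \<in> hom X (src X ?p1) (Tob X (src X ?p1))" using m(1) by (simp add: Tsrc)
  have lift_pair: "?k \<Zsemi> ?m = blift A \<Zsemi> Tar X ?k"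
  proof (rule pullback_arrow_eqI[OF dB(8) cmp_hom[OF k(1) m(1)]])
    show "blift A \<Zsemi> Tar X ?k \<in> hom X (src X (bproj A)) (src X (Tar X ?p1))"
      using cmp_hom[OF dA(9) Tk] by (simp add: Tsrc)
    have "?k \<Zsemi> ?m \<Zsemi> Tar X ?p1 = f \<Zsemi> ?l"
      using cmp_assoc[OF k(1) m1 T1] cmp_assoc[OF k(1) p1 dB(9)] by (simp add: m k)
    also have "\<dots> = blift A \<Zsemi> Tar X ?k \<Zsemi> Tar X ?p1"
      by (simp add: cmp_assoc[OF dA(9) Tk T1] Tar_cmp[OF k(1) p1, symmetric] k f'(3))
    finally show "?k \<Zsemi> ?m \<Zsemi> Tar X ?p1 = blift A \<Zsemi> Tar X ?k \<Zsemi> Tar X ?p1" .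
    have "?k \<Zsemi> ?m \<Zsemi> Tar X ?p2 = g \<Zsemi> ?l"
      using cmp_assoc[OF k(1) m1 T2] cmp_assoc[OF k(1) p2 dB(9)] by (simp add: m k)
    also have "\<dots> = blift A \<Zsemi> Tar X ?k \<Zsemi> Tar X ?p2"
      by (simp add: cmp_assoc[OF dA(9) Tk T2] Tar_cmp[OF k(1) p2, symmetric] k g'(3))
    finally show "?k \<Zsemi> ?m \<Zsemi> Tar X ?p2 = blift A \<Zsemi> Tar X ?k \<Zsemi> Tar X ?p2" .
  qed
  show ?thesis
  proof (rule DB_arrI[OF A B cmp_hom[OF k(1) dB(5)]])
    show "?k \<Zsemi> bsum B \<Zsemi> bproj B = bproj A"
      by (simp add: cmp_assoc[OF k(1) dB(5) dB(2)] dB(6) cmp_assoc[OF k(1) p1 dB(2), symmetric] k f')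
    have "?k \<Zsemi> bsum B \<Zsemi> ?l = ?k \<Zsemi> ?m \<Zsemi> Tar X (bsum B)"
      by (simp add: cmp_assoc[OF k(1) dB(5) dB(9)] dB(12) cmp_assoc[OF k(1) m1 Tar_hom[OF dB(5)]])
    also have "\<dots> = blift A \<Zsemi> Tar X (?k \<Zsemi> bsum B)"
      by (simp add: lift_pair cmp_assoc[OF dA(9) Tk Tar_hom[OF dB(5)]] Tar_cmp[OF k(1) dB(5)])
    finally show "?k \<Zsemi> bsum B \<Zsemi> ?l = blift A \<Zsemi> Tar X (?k \<Zsemi> bsum B)" .
  qed
qed

lemma sum_zero:
  assumes f: "(A, f, B) \<in> arr (DB X E)"
  shows "pair X (bfst B) (bsnd B) (bproj A \<Zsemi> bzero B) f \<Zsemi> bsum B = f"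
    and "pair X (bfst B) (bsnd B) f (bproj A \<Zsemi> bzero B) \<Zsemi> bsum B = f"
proof -
  have B: "B \<in> obj (DB X E)" using f by (simp add: DB_arr_iff)
  note d = differential_bundleD[OF B] and f' = DB_arrD[OF f]
  have i: "ident X (src X (bproj B)) \<in> hom X (src X (bproj B)) (src X (bproj B))"
    using d(2) src_obj ident_hom by (auto simp: hom_def)
  have qz: "bproj B \<Zsemi> bzero B \<in> hom X (src X (bproj B)) (src X (bproj B))"
    by (rule cmp_hom[OF d(2,3)])
  have e: "bproj B \<Zsemi> bzero B \<Zsemi> bproj B = ident X (src X (bproj B)) \<Zsemi> bproj B"
    by (simp add: cmp_assoc[OF d(2,3,2)] d(4) cmp_ident[OF d(2)] ident_cmp[OF d(2)])
  have fqz: "f \<Zsemi> (bproj B \<Zsemi> bzero B) = bproj A \<Zsemi> bzero B"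
    by (simp add: cmp_assoc[OF f'(1) d(2,3), symmetric] f'(2))
  have fi: "f \<Zsemi> ident X (src X (bproj B)) = f" by (rule cmp_ident[OF f'(1)])
  show "pair X (bfst B) (bsnd B) (bproj A \<Zsemi> bzero B) f \<Zsemi> bsum B = f"
    using cmp_pair[OF d(7) qz i e f'(1)] d(13)
      cmp_assoc[OF f'(1) pair_into_pullback(1)[OF d(7) qz i e] d(5)] fqz fi by simp
  show "pair X (bfst B) (bsnd B) f (bproj A \<Zsemi> bzero B) \<Zsemi> bsum B = f"
    using cmp_pair[OF d(7) i qz e[symmetric] f'(1)] d(14)
      cmp_assoc[OF f'(1) pair_into_pullback(1)[OF d(7) i qz e[symmetric]] d(5)] fqz fi by simp
qed

lemma cmp_sum:
  assumes h: "h \<in> hom X Y (src X (bproj A))"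
    and f: "(A, f, B) \<in> arr (DB X E)" and g: "(A, g, B) \<in> arr (DB X E)"
  shows "h \<Zsemi> (pair X (bfst B) (bsnd B) f g \<Zsemi> bsum B) =
    pair X (bfst B) (bsnd B) (h \<Zsemi> f) (h \<Zsemi> g) \<Zsemi> bsum B"
proof -
  have B: "B \<in> obj (DB X E)" using f by (simp add: DB_arr_iff)
  note d = differential_bundleD[OF B] and f' = DB_arrD[OF f] and g' = DB_arrD[OF g]
  have e: "f \<Zsemi> bproj B = g \<Zsemi> bproj B" by (simp add: f' g')
  show ?thesis
    by (simp add: cmp_assoc[OF h pair_into_pullback(1)[OF d(7) f'(1) g'(1) e] d(5), symmetric]
        cmp_pair[OF d(7) f'(1) g'(1) e h])
qed

text \<open>The coprojections \<open>i\<close> and \<open>h\<close> of a pushout are jointly epic among linear morphisms. The sum on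
  the left is linear, and after either coprojection one of its summands is zero.\<close>

lemma DB_pushout_split:
  assumes po: "is_pushout (DB X E) (Z, x, A) (Z, y, B) (A, i, P) (B, h, P)"
    and r: "(P, r, A) \<in> arr (DB X E)" and d: "(P, d, B) \<in> arr (DB X E)"
    and ir: "i \<Zsemi> r = ident X (src X (bproj A))" and id: "i \<Zsemi> d = bproj A \<Zsemi> bzero B"
    and hr: "h \<Zsemi> r = bproj B \<Zsemi> bzero A" and hd: "h \<Zsemi> d = ident X (src X (bproj B))"
    and zi: "bzero A \<Zsemi> i = bzero P" and zh: "bzero B \<Zsemi> h = bzero P"
  shows "pair X (bfst P) (bsnd P) (r \<Zsemi> i) (d \<Zsemi> h) \<Zsemi> bsum P = ident X (src X (bproj P))"
    (is "?S = _")
proof -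
  note i = DB_pushout_arr(3)[OF po] and h = DB_pushout_arr(4)[OF po]
  have A: "A \<in> obj (DB X E)" and B: "B \<in> obj (DB X E)" and P: "P \<in> obj (DB X E)"
    using i h by (auto simp: DB_arr_iff)
  note dA = differential_bundleD[OF A] and dB = differential_bundleD[OF B]
  note i' = DB_arrD[OF i] and h' = DB_arrD[OF h] and r' = DB_arrD[OF r] and d' = DB_arrD[OF d]
  note f = DB_cmp_arr[OF r i] and g = DB_cmp_arr[OF d h]
  have "i \<Zsemi> (r \<Zsemi> i) = i"
    by (simp add: cmp_assoc[OF i'(1) r'(1) i'(1), symmetric] ir ident_cmp[OF i'(1)])
  moreover have "i \<Zsemi> (d \<Zsemi> h) = bproj A \<Zsemi> bzero P"
    by (simp add: cmp_assoc[OF i'(1) d'(1) h'(1), symmetric] id cmp_assoc[OF dA(2) dB(3) h'(1)] zh)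
  ultimately have on_i: "i \<Zsemi> ?S = i"
    by (simp add: cmp_sum[OF i'(1) f g] sum_zero(2)[OF i])
  have "h \<Zsemi> (r \<Zsemi> i) = bproj B \<Zsemi> bzero P"
    by (simp add: cmp_assoc[OF h'(1) r'(1) i'(1), symmetric] hr cmp_assoc[OF dB(2) dA(3) i'(1)] zi)
  moreover have "h \<Zsemi> (d \<Zsemi> h) = h"
    by (simp add: cmp_assoc[OF h'(1) d'(1) h'(1), symmetric] hd ident_cmp[OF h'(1)])
  ultimately have on_h: "h \<Zsemi> ?S = h"
    by (simp add: cmp_sum[OF h'(1) f g] sum_zero(1)[OF h])
  show ?thesis
    using DB_pushout_universal[OF po i h DB_pushout_commutes[OF po]] DB_sum[OF f g] DB_ident[OF P]
      on_i on_h cmp_ident[OF i'(1)] cmp_ident[OF h'(1)] by blast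
qed

end

section \<open>The vertical connection of a full horizontal connection\<close>

theorem proposition3p30:
  fixes X :: "('o, 'a) tangent_structure"
    and q \<iota> t u H :: 'a
    and V F :: "'a dbundle"
  assumes "tangent_category X"
    and "vertical_bundle X q V \<iota> t"
    and "finsler_bundle X q F u"
    and "submersion X q V \<iota> F u"
    and "full_horizontal_connection X q V \<iota> F u H"
  shows "\<exists>!R. vertical_connection X q V \<iota> R \<and> ehresmann_connection X q V \<iota> F u R H"
proof -
  interpret tangent_category X by fact
  define E P Z D where "E = src X q" and "P = tan_dbundle X E" and "Z = trivial_dbundle X E"
    and "D = horizontal_descent X q F u"
  note defs = E_def P_def Z_def D_def
  have sub: "is_pushout (DB X E) (V, \<iota>, P) (V, bproj V, Z) (P, D, F) (Z, bzero F, F)"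
    using assms(4) by (simp add: submersion_def Let_def defs)
  have full: "is_pushout (DB X E) (Z, bzero V, V) (Z, bzero F, F) (V, \<iota>, P) (F, H, P)"
    and horizontal: "horizontal_connection X q F u H"
    using assms(5) by (simp_all add: full_horizontal_connection_def Let_def defs)
  have HD: "H \<Zsemi>\<^bsub>X\<^esub> D = ident X (src X (bproj F))"
    using horizontal by (simp add: horizontal_connection_def Let_def defs)
  have zVi: "bzero V \<Zsemi>\<^bsub>X\<^esub> \<iota> = tan_z X E"
    using assms(2) by (simp add: vertical_bundle_def Let_def defs)
  have zFq: "bzero F \<Zsemi>\<^bsub>X\<^esub> bproj F = ident X E"
    using assms(3) by (simp add: finsler_bundle_def Let_def defs)
  note \<iota> = DB_pushout_arr(3)[OF full] and H = DB_pushout_arr(4)[OF full]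
    and D = DB_pushout_arr(3)[OF sub]
  have V: "V \<in> obj (DB X E)" and F: "F \<in> obj (DB X E)" and P: "P \<in> obj (DB X E)"
    using \<iota> H by (auto simp: DB_arr_iff)
  note dV = differential_bundleD[OF V] and dF = differential_bundleD[OF F]
    and dP = differential_bundleD[OF P]
  have Psel: "bproj P = tan_p X E" "bzero P = tan_z X E" "bfst P = tan_fst X E"
    "bsnd P = tan_snd X E" "bsum P = tan_s X E"
    by (simp_all add: P_def tan_dbundle_def)
  have sP: "src X (bproj P) = Tob X E"
    using p_hom[OF dP(1)] by (simp add: Psel hom_def)
  have s\<iota>: "src X \<iota> = src X (bproj V)"
    using DB_arrD(1)[OF \<iota>] by (simp add: hom_def)
  have zFH: "bzero F \<Zsemi>\<^bsub>X\<^esub> H = bzero P"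
    using DB_pushout_commutes[OF full] zVi by (simp add: Psel)
  have vertical_iff: "vertical_connection X q V \<iota> R \<longleftrightarrow>
      (P, R, V) \<in> arr (DB X E) \<and> \<iota> \<Zsemi>\<^bsub>X\<^esub> R = ident X (src X (bproj V))" for R
    using P V by (simp add: vertical_connection_def Let_def DB_arr_iff s\<iota> defs)
  \<comment> \<open>The cocone that defines \<open>R\<close>: the identity on \<open>Vq\<close> and the zero morphism on \<open>Fq\<close>.\<close>
  have "bzero V \<Zsemi>\<^bsub>X\<^esub> ident X (src X (bproj V)) = bzero F \<Zsemi>\<^bsub>X\<^esub> (bproj F \<Zsemi>\<^bsub>X\<^esub> bzero V)"
    by (simp add: cmp_ident[OF dV(3)] cmp_assoc[OF dF(3,2) dV(3), symmetric] zFq ident_cmp[OF dV(3)])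
  from DB_pushout_universal[OF full DB_ident[OF V] DB_zero[OF F V] this]
  have uniq: "\<exists>!R. (P, R, V) \<in> arr (DB X E) \<and> \<iota> \<Zsemi>\<^bsub>X\<^esub> R = ident X (src X (bproj V)) \<and>
      H \<Zsemi>\<^bsub>X\<^esub> R = bproj F \<Zsemi>\<^bsub>X\<^esub> bzero V" .
  have split: "pair X (tan_fst X E) (tan_snd X E) (R \<Zsemi>\<^bsub>X\<^esub> \<iota>) (D \<Zsemi>\<^bsub>X\<^esub> H) \<Zsemi>\<^bsub>X\<^esub> tan_s X E =
      ident X (Tob X E)"
    if R: "(P, R, V) \<in> arr (DB X E)" and \<iota>R: "\<iota> \<Zsemi>\<^bsub>X\<^esub> R = ident X (src X (bproj V))"
      and HR: "H \<Zsemi>\<^bsub>X\<^esub> R = bproj F \<Zsemi>\<^bsub>X\<^esub> bzero V" for R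
    using DB_pushout_split[OF full R D \<iota>R DB_pushout_commutes[OF sub] HR HD] zVi zFH
    by (simp add: Psel[symmetric] sP)
  \<comment> \<open>By \<open>split\<close>, the sum condition follows from the other conditions on \<open>R\<close>, and these are exactly
    the ones that determine \<open>R\<close> by the universal property.\<close>
  have "vertical_connection X q V \<iota> R \<and> ehresmann_connection X q V \<iota> F u R H \<longleftrightarrow>
      (P, R, V) \<in> arr (DB X E) \<and> \<iota> \<Zsemi>\<^bsub>X\<^esub> R = ident X (src X (bproj V)) \<and>
      H \<Zsemi>\<^bsub>X\<^esub> R = bproj F \<Zsemi>\<^bsub>X\<^esub> bzero V" for R
    using split[of R] horizontal
    by (auto simp: vertical_iff ehresmann_connection_def Let_def E_def[symmetric] D_def[symmetric])
  then show ?thesis using uniq by simp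
qed

end
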